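(* Let $n\in\mathbb{N}$ and let $\mathcal{T}_n$ be a finite tree with $n$ vertices, vertex set $V(\mathcal{T}_n)$, and vertex degrees $d_u$, $u\in V(\mathcal{T}_n)$. Let $N_n^+$ and $N_n^-$ be the number of vertices with strictly positive, respectively strictly negative, friendship-bias in $\mathcal{T}_n$. Then the following hold. (a) If there is a $u\in V(\mathcal{T}_n)$ such that $d_u\ge 3$, then $$N_n^+ - N_n^- \;\geq\; 2 + \sum_{u \in V(\mathcal{T}_n)} (d_u-3)\, \mathbf{1}_{\{d_u \geq 3\}} \;>\; 0.$$ (b) If $\mathcal{T}_n$ is a path of size $n$ (i.e., a path with $n$ vertices), then $$N_n^+-N_n^-=\mathbf{1}_{\{n=3\}}.$$
   Context: For a vertex $u$ of a tree $\mathcal{T}_n$ with $n$ vertices, write $v\sim u$ if $v$ is adjacent to $u$, and let $d_u$ be the degree of $u$. The friendship-bias of $u$ is $$\Delta_{u,n} = \frac{1}{d_u}\sum_{v\in V(\mathcal{T}_n),\, v\sim u} d_v - d_u,$$ with the convention that in the trivial one-vertex tree the friendship-bias of the single vertex is $0$. Then $N_n^+ = |\{u\in V(\mathcal{T}_n): \Delta_{u,n}>0\}|$ and $N_n^- = |\{u\in V(\mathcal{T}_n): \Delta_{u,n}<0\}|$. *)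

theory Defs
  imports Complex_Main "Graph_Theory.Graph_Theory"
begin

text \<open>
  A finite simple graph is a \<open>pair_graph\<close>: each edge \<open>{u, v}\<close> is represented by the two
  arcs \<open>(u, v)\<close> and \<open>(v, u)\<close>. Hence the out-degree of a vertex is its degree as a vertex
  of an undirected graph.
\<close>

abbreviation deg :: "'a pair_pre_digraph \<Rightarrow> 'a \<Rightarrow> nat" where
  "deg G u \<equiv> out_degree (with_proj G) u"

lemma deg_eq_card_neighbours:
  assumes "pair_graph G"
  shows "deg G u = card {v \<in> pverts G. u \<rightarrow>\<^bsub>with_proj G\<^esub> v}"
proof -
  interpret pair_graph G by (rule assms)
  have "out_arcs (with_proj G) u = Pair u ` {v \<in> pverts G. u \<rightarrow>\<^bsub>with_proj G\<^esub> v}"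
    by (auto simp: out_arcs_def dest: in_arcsD2)
  then show ?thesis
    by (simp add: out_degree_def card_image inj_on_def)
qed

text \<open>
  The predicate \<open>tree\<close> of \<open>Graph_Theory\<close> cannot be used here: in a symmetric digraph every
  edge yields the closed walk \<open>u, v, u\<close>, which \<open>pre_digraph.cycle\<close> counts as a cycle. The
  cycles of the undirected graph are those of length at least 3. The null graph is not
  connected.
\<close>

definition undirected_tree :: "'a pair_pre_digraph \<Rightarrow> bool" where
  "undirected_tree G \<longleftrightarrow>
     pair_graph G \<and> Digraph_Component.connected (with_proj G) \<and>
     \<not> (\<exists>p. pre_digraph.cycle (with_proj G) p \<and> 3 \<le> length p)"

definition path_graph :: "'a pair_pre_digraph \<Rightarrow> bool" where
  "path_graph G \<longleftrightarrow>
     (\<exists>p. p \<noteq> [] \<and> distinct p \<and> pverts G = set p \<and>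
          parcs G = set (vwalk_arcs p) \<union> (set (vwalk_arcs p))\<inverse>)"

text \<open>
  For the only vertex of the one-vertex tree, division by zero gives \<open>0 / 0 - 0 = 0\<close>, which is
  the usual convention for that case.
\<close>

definition friendship_bias :: "'a pair_pre_digraph \<Rightarrow> 'a \<Rightarrow> real" where
  "friendship_bias G u =
     1 / real (deg G u) * (\<Sum>v | v \<in> pverts G \<and> u \<rightarrow>\<^bsub>with_proj G\<^esub> v. real (deg G v)) - real (deg G u)"

definition N_plus :: "'a pair_pre_digraph \<Rightarrow> nat" where
  "N_plus G = card {u \<in> pverts G. friendship_bias G u > 0}"

definition N_minus :: "'a pair_pre_digraph \<Rightarrow> nat" where
  "N_minus G = card {u \<in> pverts G. friendship_bias G u < 0}"

end

theory Submission
  imports Defs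
begin

text \<open>
  Call a vertex of degree at least 3 a branching vertex, and let \<open>L\<close> and \<open>B\<close> be the numbers of
  leaves and of branching vertices. A tree has at most \<open>n - 1\<close> edges, so the degrees
  satisfy \<open>(\<Sum>u. deg u - 2) \<le> - 2\<close>. In this sum a leaf contributes \<open>- 1\<close>, a vertex of degree 2
  contributes \<open>0\<close> and a branching vertex contributes \<open>(deg u - 3) + 1\<close>. Hence \<open>L - B\<close> is at least
  the claimed lower bound (\<open>card_leaves_ge\<close>), and for (a) it suffices to show that
  \<open>N_plus G - N_minus G \<ge> L - B\<close>.

  In a tree with a branching vertex, the neighbour of a leaf is not a leaf, so every leaf has
  positive bias. Branching vertices cost at most \<open>B\<close>, even if all of them have negative bias. It
  remains to see that among the vertices of degree 2 the negative ones do not outnumber the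
  positive ones (\<open>card_neg_deg_2_le_card_pos_deg_2\<close>). A negative vertex \<open>v\<close> of degree 2 is
  adjacent to a leaf \<open>l\<close>. Walk from \<open>l\<close> through \<open>v\<close> and onwards along vertices of degree 2, never
  turning back. The walk ends at a branching vertex, since otherwise the vertices on it would be
  closed under adjacency and form the whole tree. The vertex \<open>x\<close> before the end has a neighbour of
  degree 2 and a branching neighbour, so its bias is positive. Walking back from \<open>x\<close> recovers
  \<open>v\<close>, so \<open>v \<mapsto> x\<close> is injective.

  For (b), the signs on a path can be read off from the positions: for \<open>n \<ge> 4\<close> the two ends are
  positive and their two neighbours are negative, while for \<open>n = 3\<close> these two neighbours
  coincide. For smaller \<open>n\<close> every bias is zero.
\<close>

section \<open>Neighbourhoods and the sign of the friendship-bias\<close>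

abbreviation nbrs :: "'a pair_pre_digraph \<Rightarrow> 'a \<Rightarrow> 'a set" where
  "nbrs G u \<equiv> parcs G `` {u}"

context pair_graph
begin

lemma finite_nbrs [simp]: "finite (nbrs G u)"
  using pair_finite_arcs by (rule finite_Image)

lemma nbrs_subset_verts: "nbrs G u \<subseteq> pverts G"
  by (auto dest: in_arcsD2)

lemma deg_eq_card_nbrs: "deg G u = card (nbrs G u)"
proof -
  have "{v \<in> pverts G. u \<rightarrow>\<^bsub>with_proj G\<^esub> v} = nbrs G u"
    by (auto dest: in_arcsD2)
  then show ?thesis
    using deg_eq_card_neighbours[OF pair_graph] by simp
qed

lemma card_parcs_eq_sum_deg: "card (parcs G) = (\<Sum>u\<in>pverts G. deg G u)"
proof -
  have "parcs G = (SIGMA u:pverts G. nbrs G u)"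
    by (auto dest: in_arcsD1)
  then have "card (parcs G) = card (SIGMA u:pverts G. nbrs G u)"
    by (rule arg_cong)
  also have "\<dots> = (\<Sum>u\<in>pverts G. card (nbrs G u))"
    using pair_finite_verts by (intro card_SigmaI) auto
  finally show ?thesis
    by (simp only: deg_eq_card_nbrs)
qed

text \<open>
  The sign of the bias is decided by natural numbers, after multiplication by the degree. The
  equivalences cover an isolated vertex too: there the bias, the sum and the square are all 0.
\<close>

lemma friendship_bias_sgn:
  shows friendship_bias_pos_iff:
    "0 < friendship_bias G u \<longleftrightarrow> deg G u * deg G u < (\<Sum>v\<in>nbrs G u. deg G v)" (is ?pos)
  and friendship_bias_neg_iff:
    "friendship_bias G u < 0 \<longleftrightarrow> (\<Sum>v\<in>nbrs G u. deg G v) < deg G u * deg G u" (is ?neg)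
proof -
  have N: "{v. v \<in> pverts G \<and> u \<rightarrow>\<^bsub>with_proj G\<^esub> v} = nbrs G u"
    by (auto dest: in_arcsD2)
  define S where "S = (\<Sum>v\<in>nbrs G u. deg G v)"
  have bias: "friendship_bias G u = real S / real (deg G u) - real (deg G u)"
    unfolding friendship_bias_def N S_def by simp
  have "?pos \<and> ?neg"
  proof (cases "deg G u = 0")
    case True
    then have "nbrs G u = {}"
      by (simp add: deg_eq_card_nbrs)
    then show ?thesis
      using True bias by (simp add: S_def)
  next
    case False
    then have "0 < real (deg G u)"
      by simp
    then have "0 < friendship_bias G u \<longleftrightarrow> real (deg G u * deg G u) < real S"
      and "friendship_bias G u < 0 \<longleftrightarrow> real S < real (deg G u * deg G u)"
      unfolding bias by (simp_all add: field_simps)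
    then show ?thesis
      unfolding S_def of_nat_less_iff by blast
  qed
  then show ?pos ?neg by blast+
qed

lemma connected_closed_set_superset:
  assumes "Digraph_Component.connected (with_proj G)"
    and "s \<in> S" "s \<in> pverts G"
    and closed: "\<And>u v. u \<in> S \<Longrightarrow> (u, v) \<in> parcs G \<Longrightarrow> v \<in> S"
  shows "pverts G \<subseteq> S"
proof
  fix v assume "v \<in> pverts G"
  with assms have "s \<rightarrow>\<^sup>*\<^bsub>with_proj G\<^esub> v"
    using symmetric_connected_imp_strongly_connected[OF pair_sym_arcs]
    by (auto simp: strongly_connected_def)
  then show "v \<in> S"
    by (induction rule: reachable_induct) (use assms(2) closed in auto)
qed

end

section \<open>An acyclic graph has fewer edges than vertices\<close>

lemma vwalk_arcs_pcas: "pcas x (vwalk_arcs (x # p)) (last (x # p))"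
  by (induction p arbitrary: x) auto

lemma vwalk_arcs_pawalk_verts: "pawalk_verts x (vwalk_arcs (x # p)) = x # p"
  by (induction p arbitrary: x) auto

lemma length_vwalk_arcs: "length (vwalk_arcs p) = length p - 1"
  by (induction p rule: vwalk_arcs.induct) auto

context pair_graph
begin

text \<open>
  Cycles are lists of arcs, while longest paths are easier to handle as lists of vertices. The
  cycle is the walk that starts with the arc from the last vertex of the path back to the first.
\<close>

lemma cycle_of_closed_vwalk:
  assumes "distinct q" "3 \<le> length q" "set (vwalk_arcs q) \<subseteq> parcs G"
    and "(last q, hd q) \<in> parcs G"
  shows "\<exists>p. cycle p \<and> 3 \<le> length p"
proof -
  let ?q = "last q # q" and ?p = "vwalk_arcs (last q # q)"
  have "q \<noteq> []"
    using assms by auto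
  then have p: "set ?p \<subseteq> parcs G" "length ?p = length q"
    using assms by (simp_all add: length_vwalk_arcs)
  have "awalk (last q) ?p (last q)"
    unfolding awalk_def
    using p assms(4) vwalk_arcs_pcas[of "last q" q] \<open>q \<noteq> []\<close>
    by (auto dest: in_arcsD1)
  moreover have "distinct (tl (pawalk_verts (last q) ?p))"
    unfolding vwalk_arcs_pawalk_verts using assms(1) by simp
  moreover have "?p \<noteq> []"
    using p assms(2) by auto
  ultimately have "cycle ?p"
    unfolding cycle_def by (intro exI[of _ "last q"] conjI)
  with p assms(2) show ?thesis
    by (intro exI[of _ ?p]) simp
qed

text \<open>
  The first vertex \<open>x\<close> of a longest path inside \<open>A\<close> has all its neighbours in \<open>A\<close> on that path, as
  otherwise the path could be prolonged. A neighbour beyond the second vertex of the path would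
  close a cycle. The set \<open>A\<close> is arbitrary so that vertices can be removed one by one without
  passing to a subgraph.
\<close>

lemma acyclic_imp_low_degree_vertex:
  assumes acyclic: "\<not> (\<exists>p. cycle p \<and> 3 \<le> length p)"
    and "finite A" "A \<noteq> {}"
  shows "\<exists>u\<in>A. card (nbrs G u \<inter> A) \<le> 1"
proof -
  \<comment> \<open>Vertex lists of the paths inside \<open>A\<close>.\<close>
  define Q where
    "Q q \<longleftrightarrow> q \<noteq> [] \<and> distinct q \<and> set q \<subseteq> A \<and> set (vwalk_arcs q) \<subseteq> parcs G" for q
  obtain a where "a \<in> A"
    using assms by blast
  then have "Q [a]"
    by (simp add: Q_def)
  moreover have "length q \<le> card A" if "Q q" for q
    using that card_mono[OF \<open>finite A\<close>, of "set q"] by (simp add: Q_def distinct_card)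
  ultimately obtain q where "Q q" and longest: "\<And>q'. Q q' \<Longrightarrow> length q' \<le> length q"
    using ex_has_greatest_nat[of Q "[a]" length "Suc (card A)"] by (auto simp: less_Suc_eq_le)
  then obtain x r where q: "q = x # r"
    by (auto simp: Q_def neq_Nil_conv)
  have nbrs_on_path: "nbrs G x \<inter> A \<subseteq> set r"
  proof
    fix z assume z: "z \<in> nbrs G x \<inter> A"
    show "z \<in> set r"
    proof (rule ccontr)
      assume "z \<notin> set r"
      moreover have "z \<noteq> x"
        using z no_loops' by auto
      ultimately have "Q (z # q)"
        using \<open>Q q\<close> z arcs_symmetric by (auto simp: Q_def q)
      then show False
        using longest by fastforce
    qed
  qed
  have "nbrs G x \<inter> A \<subseteq> {hd r}"
  proof (rule ccontr)
    assume "\<not> nbrs G x \<inter> A \<subseteq> {hd r}"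
    then obtain z where z: "(x, z) \<in> parcs G" "z \<in> A" "z \<noteq> hd r"
      by auto
    then have "z \<in> set r"
      using nbrs_on_path by auto
    then obtain r1 r2 where r: "r = r1 @ z # r2"
      by (meson split_list)
    with z have "r1 \<noteq> []"
      by auto
    let ?c = "x # r1 @ [z]"
    have "q = ?c @ r2"
      by (simp add: q r)
    then have "distinct ?c" "set (vwalk_arcs ?c) \<subseteq> parcs G"
      using \<open>Q q\<close> set_vwalk_arcs_append1[of ?c r2] by (auto simp: Q_def)
    moreover have "3 \<le> length ?c"
      using \<open>r1 \<noteq> []\<close> by (cases r1) auto
    moreover have "(last ?c, hd ?c) \<in> parcs G"
      using z arcs_symmetric by simp
    ultimately show False
      using cycle_of_closed_vwalk acyclic by blast
  qed
  then have "card (nbrs G x \<inter> A) \<le> 1"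
    using card_mono[of "{hd r}"] by fastforce
  then show ?thesis
    using \<open>Q q\<close> by (auto simp: Q_def q)
qed

text \<open>
  Removing a vertex with at most one neighbour in \<open>A\<close> removes at most one edge, that is, two arcs.
\<close>

lemma acyclic_imp_card_arcs_le:
  assumes acyclic: "\<not> (\<exists>p. cycle p \<and> 3 \<le> length p)"
    and "finite A" "A \<noteq> {}"
  shows "card (parcs G \<inter> A \<times> A) + 2 \<le> 2 * card A"
  using assms(2,3)
proof (induction rule: finite_psubset_induct)
  case (psubset A)
  obtain u where u: "u \<in> A" "card (nbrs G u \<inter> A) \<le> 1"
    using acyclic_imp_low_degree_vertex[OF acyclic psubset.hyps psubset.prems] by blast
  define B where "B = A - {u}"
  let ?N = "nbrs G u \<inter> A"
  have card_A: "card A = Suc (card B)"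
    using card.remove[OF psubset.hyps u(1)] by (simp only: B_def)
  show ?case
  proof (cases "B = {}")
    case True
    then have "A \<subseteq> {u}"
      by (auto simp: B_def)
    then have "parcs G \<inter> A \<times> A = {}"
      using no_loops' by blast
    then show ?thesis
      by (simp add: card_A True)
  next
    case False
    have "parcs G \<inter> A \<times> A \<subseteq> (parcs G \<inter> B \<times> B) \<union> ({u} \<times> ?N \<union> ?N \<times> {u})"
      using arcs_symmetric by (auto simp: B_def)
    then have "card (parcs G \<inter> A \<times> A)
        \<le> card ((parcs G \<inter> B \<times> B) \<union> ({u} \<times> ?N \<union> ?N \<times> {u}))"
      using pair_finite_arcs by (intro card_mono) auto
    also have "\<dots> \<le> card (parcs G \<inter> B \<times> B) + (card ({u} \<times> ?N) + card (?N \<times> {u}))"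
      by (meson add_left_mono card_Un_le order_trans)
    also have "\<dots> \<le> card (parcs G \<inter> B \<times> B) + 2"
      using u by (simp add: card_cartesian_product)
    finally have "card (parcs G \<inter> A \<times> A) \<le> card (parcs G \<inter> B \<times> B) + 2" .
    moreover have "card (parcs G \<inter> B \<times> B) + 2 \<le> 2 * card B"
      using False u by (intro psubset.IH) (auto simp: B_def)
    ultimately show ?thesis
      by (simp add: card_A)
  qed
qed

end

section \<open>Trees with a branching vertex\<close>

locale branching_tree = pair_graph +
  assumes connected: "Digraph_Component.connected (with_proj G)"
    and acyclic: "\<not> (\<exists>p. cycle p \<and> 3 \<le> length p)"
    and branching: "\<exists>u\<in>pverts G. 3 \<le> deg G u"
begin

text \<open>
  This is how connectedness enters below: a set of vertices of degree at most 2 cannot be closed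
  under adjacency.
\<close>

lemma closed_set_contains_branching:
  assumes "s \<in> S" "s \<in> pverts G"
    and "\<And>u v. u \<in> S \<Longrightarrow> (u, v) \<in> parcs G \<Longrightarrow> v \<in> S"
  shows "\<exists>u\<in>S. 3 \<le> deg G u"
proof -
  have "pverts G \<subseteq> S"
    by (rule connected_closed_set_superset[OF connected assms(1,2)]) (fact assms(3))
  then show ?thesis
    using branching by blast
qed

lemma deg_pos: "u \<in> pverts G \<Longrightarrow> 1 \<le> deg G u"
proof (rule ccontr)
  assume u: "u \<in> pverts G" "\<not> 1 \<le> deg G u"
  then have "deg G u = 0"
    by simp
  then have "nbrs G u = {}"
    by (simp add: deg_eq_card_nbrs)
  then show False
    using closed_set_contains_branching[of u "{u}"] u by auto
qed

lemma leaf_bias_pos: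
  assumes "deg G u = 1"
  shows "0 < friendship_bias G u"
proof -
  obtain v where v: "nbrs G u = {v}"
    using assms by (auto simp: deg_eq_card_nbrs card_1_singleton_iff)
  then have uv: "(u, v) \<in> parcs G"
    by auto
  have "deg G v \<noteq> 1"
  proof
    assume "deg G v = 1"
    then obtain w where "nbrs G v = {w}"
      by (auto simp: deg_eq_card_nbrs card_1_singleton_iff)
    moreover have "u \<in> nbrs G v"
      using arcs_symmetric[OF uv] by auto
    ultimately have "nbrs G v = {u}"
      by auto
    with v have "\<exists>x\<in>{u, v}. 3 \<le> deg G x"
      using in_arcsD1[OF uv] by (intro closed_set_contains_branching[of u]) auto
    with \<open>deg G u = 1\<close> \<open>deg G v = 1\<close> show False
      by simp
  qed
  then have "1 < deg G v"
    using deg_pos[OF in_arcsD2[OF uv]] by simp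
  then show ?thesis
    using assms by (simp add: friendship_bias_pos_iff v)
qed

text \<open>
  One step of a walk that passes through a vertex of degree 2 without turning back. The steps
  relate arcs rather than vertices, because the direction of travel is needed to determine the
  next vertex and to make the walk reversible.
\<close>

definition thread :: "(('a \<times> 'a) \<times> 'a \<times> 'a) set" where
  "thread = {((a, b), (b, c)) | a b c.
      (a, b) \<in> parcs G \<and> (b, c) \<in> parcs G \<and> deg G b = 2 \<and> a \<noteq> c}"

lemma thread_iff:
  "((a, b), (b', c)) \<in> thread \<longleftrightarrow>
     b' = b \<and> (a, b) \<in> parcs G \<and> (b, c) \<in> parcs G \<and> deg G b = 2 \<and> a \<noteq> c"
  by (auto simp: thread_def)

lemma nbrs_deg_2:
  assumes "deg G b = 2" "a \<in> nbrs G b" "c \<in> nbrs G b" "a \<noteq> c"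
  shows "nbrs G b = {a, c}"
  using assms by (intro card_subset_eq[symmetric]) (auto simp: deg_eq_card_nbrs)

lemma single_valued_converse_thread: "single_valued (thread\<inverse>)"
proof (rule single_valuedI)
  fix e f g assume "(e, f) \<in> thread\<inverse>" "(e, g) \<in> thread\<inverse>"
  then obtain a a' b c where *: "f = (a, b)" "g = (a', b)" "a \<noteq> c" "a' \<noteq> c"
      "(a, b) \<in> parcs G" "(a', b) \<in> parcs G" "(b, c) \<in> parcs G" "deg G b = 2"
    by (auto simp: thread_def)
  have "nbrs G b = {a, c}" "a' \<in> nbrs G b"
    using * arcs_symmetric nbrs_deg_2[of b a c] by blast+
  with * show "f = g"
    by auto
qed

text \<open>
  Two threads that end with the same arc agree going backwards, so one starting arc lies on the
  thread of the other. An arc out of a leaf has no predecessor, so the starting arcs coincide.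
\<close>

lemma thread_from_leaf_unique:
  assumes "deg G l = 1" "deg G l' = 1"
    and "((l, v), e) \<in> thread\<^sup>*" "((l', v'), e) \<in> thread\<^sup>*"
  shows "(l, v) = (l', v')"
proof -
  \<comment> \<open>A middle vertex of a step has degree 2, so no step leads to an arc out of a leaf.\<close>
  have start: "f = (k, w)" if "(f, (k, w)) \<in> thread\<^sup>*" "deg G k = 1" for f k w
    using that by (cases rule: rtranclE) (auto simp: thread_def)
  have "((l, v), (l', v')) \<in> thread\<^sup>* \<or> ((l', v'), (l, v)) \<in> thread\<^sup>*"
    using single_valued_confluent[OF single_valued_converse_thread, of e "(l, v)" "(l', v')"] assms
    by (auto simp: rtrancl_converse)
  then show ?thesis
    using start assms by metis
qed

text \<open>
  If the thread met no branching vertex, then the leaf together with all vertices reached by it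
  would be closed under adjacency: at a vertex of degree 2 one neighbour is the previous vertex and
  the other is the next one, and at a vertex of degree 1 the only neighbour is the previous one.
\<close>

lemma thread_from_leaf_ends:
  assumes "deg G l = 1" "(l, v) \<in> parcs G"
  shows "\<exists>x y. ((l, v), (x, y)) \<in> thread\<^sup>* \<and> 3 \<le> deg G y"
proof (rule ccontr)
  assume no_end: "\<not> ?thesis"
  have deg_le: "deg G b \<le> 2" if "((l, v), (a, b)) \<in> thread\<^sup>*" for a b
  proof -
    have "\<not> 3 \<le> deg G b"
      using that no_end by blast
    then show ?thesis
      by simp
  qed
  have arc: "(a, b) \<in> parcs G" if "((l, v), (a, b)) \<in> thread\<^sup>*" for a b
    using that by (cases rule: rtranclE) (use assms(2) in \<open>auto simp: thread_def\<close>)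
  let ?S = "insert l {b. \<exists>a. ((l, v), (a, b)) \<in> thread\<^sup>*}"
  have tail: "a \<in> ?S" if "((l, v), (a, b)) \<in> thread\<^sup>*" for a b
    using that by (cases rule: rtranclE) (auto simp: thread_def)
  have "\<exists>u\<in>?S. 3 \<le> deg G u"
  proof (rule closed_set_contains_branching)
    show "l \<in> ?S" "l \<in> pverts G"
      using in_arcsD1[OF assms(2)] by auto
  next
    fix b c assume b: "b \<in> ?S" and bc: "(b, c) \<in> parcs G"
    show "c \<in> ?S"
    proof (cases "b = l")
      case True
      have "card (nbrs G l) = 1"
        using assms(1) by (simp only: deg_eq_card_nbrs)
      then obtain x where "nbrs G l = {x}"
        by (auto simp: card_1_singleton_iff)
      moreover have "v \<in> nbrs G l" "c \<in> nbrs G l"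
        using assms(2) bc True by auto
      ultimately have "c = v"
        by simp
      then show ?thesis
        by blast
    next
      case False
      with b obtain a where ab: "((l, v), (a, b)) \<in> thread\<^sup>*"
        by auto
      note ba = arcs_symmetric[OF arc[OF ab]]
      show ?thesis
      proof (cases "a = c")
        case True
        then show ?thesis
          using tail[OF ab] by simp
      next
        case False
        then have "card {a, c} \<le> deg G b"
          unfolding deg_eq_card_nbrs using ba bc by (intro card_mono) auto
        then have "deg G b = 2"
          using False deg_le[OF ab] by simp
        then have "((a, b), (b, c)) \<in> thread"
          using False bc arc[OF ab] by (simp add: thread_iff)
        then show ?thesis
          using ab by (blast intro: rtrancl_into_rtrancl)
      qed
    qed
  qed
  then show False
    using deg_le assms(1) by fastforce
qed

text \<open>
  Negative bias at \<open>v\<close> means that its two neighbours have degree sum less than 4, so one of them is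
  a leaf and neither is branching. The latter keeps the thread from ending right after \<open>v\<close>, so
  the vertex \<open>w\<close> before \<open>x\<close> is not the leaf, but a vertex of degree 2.
\<close>

lemma neg_deg_2_thread:
  assumes v: "deg G v = 2" "friendship_bias G v < 0"
  shows "\<exists>l x y w. deg G l = 1 \<and> ((l, v), (x, y)) \<in> thread\<^sup>* \<and> 3 \<le> deg G y \<and>
      nbrs G x = {w, y} \<and> w \<noteq> y \<and> deg G w = 2 \<and> deg G x = 2"
proof -
  have "card (nbrs G v) = 2"
    using v(1) by (simp only: deg_eq_card_nbrs)
  then obtain k m where km: "nbrs G v = {k, m}" "k \<noteq> m"
    by (auto simp: card_2_iff)
  then have "deg G k + deg G m < 4"
    using v by (simp add: friendship_bias_neg_iff)
  moreover have "1 \<le> deg G k" "1 \<le> deg G m"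
    using km nbrs_subset_verts[of v] deg_pos[of k] deg_pos[of m] by auto
  ultimately have low: "\<forall>z\<in>nbrs G v. deg G z \<le> 2" and "deg G k = 1 \<or> deg G m = 1"
    using km by auto
  then obtain l where l: "deg G l = 1" "(v, l) \<in> parcs G"
    using km by auto
  obtain x y where xy: "((l, v), (x, y)) \<in> thread\<^sup>*" "3 \<le> deg G y"
    using thread_from_leaf_ends[OF l(1) arcs_symmetric[OF l(2)]] by blast
  from xy(1) obtain w where w: "((l, v), (w, x)) \<in> thread\<^sup>*" "((w, x), (x, y)) \<in> thread"
    by (cases rule: rtranclE) (use xy(2) v(1) in \<open>auto simp: thread_def\<close>)
  then have wx: "(w, x) \<in> parcs G" "(x, y) \<in> parcs G" "w \<noteq> y" "deg G x = 2"
    by (auto simp: thread_iff)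
  then have "nbrs G x = {w, y}"
    using arcs_symmetric by (intro nbrs_deg_2) auto
  moreover have "deg G w = 2"
    using w(1)
  proof (cases rule: rtranclE)
    case base
    then have "deg G y \<le> 2"
      using low wx(2) by auto
    with xy(2) show ?thesis
      by simp
  qed (auto simp: thread_def)
  ultimately show ?thesis
    using l(1) xy wx by blast
qed

text \<open>
  The vertex \<open>x\<close> in front of the branching vertex has neighbours of degree 2 and at least 3, hence
  positive bias. It determines \<open>v\<close>: its only branching neighbour is \<open>y\<close>, so the last arc of the
  thread is \<open>(x, y)\<close>, and the thread can be traced back.
\<close>

lemma card_neg_deg_2_le_card_pos_deg_2:
  "card {u \<in> pverts G. deg G u = 2 \<and> friendship_bias G u < 0}
     \<le> card {u \<in> pverts G. deg G u = 2 \<and> 0 < friendship_bias G u}"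
proof (rule card_le_if_inj_on_rel[where
      r = "\<lambda>v x. \<exists>l y w. deg G l = 1 \<and> ((l, v), (x, y)) \<in> thread\<^sup>* \<and> 3 \<le> deg G y \<and>
        nbrs G x = {w, y} \<and> w \<noteq> y \<and> deg G w = 2"], goal_cases)
  case 1
  then show ?case
    using pair_finite_verts by simp
next
  case (2 v)
  then obtain l x y w where *: "deg G l = 1" "((l, v), (x, y)) \<in> thread\<^sup>*" "3 \<le> deg G y"
      "nbrs G x = {w, y}" "w \<noteq> y" "deg G w = 2" "deg G x = 2"
    using neg_deg_2_thread by blast
  then have "(x, y) \<in> parcs G"
    by auto
  then have "x \<in> pverts G"
    by (rule in_arcsD1)
  moreover have "0 < friendship_bias G x"
    using * by (simp add: friendship_bias_pos_iff)
  ultimately show ?case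
    using * by blast
next
  case (3 v v' x)
  then obtain l y w l' y' w' where
    e: "deg G l = 1" "((l, v), (x, y)) \<in> thread\<^sup>*" "3 \<le> deg G y" "nbrs G x = {w, y}" "deg G w = 2"
    and e': "deg G l' = 1" "((l', v'), (x, y')) \<in> thread\<^sup>*" "3 \<le> deg G y'" "nbrs G x = {w', y'}"
      "deg G w' = 2"
    by blast
  have "y' \<in> {w, y}"
    using e(4) e'(4) by blast
  then have "y' = y"
    using e(5) e'(3) by auto
  then show ?case
    using thread_from_leaf_unique[OF e(1) e'(1) e(2)] e'(2) by simp
qed

text \<open>
  This rearranges \<open>(\<Sum>u. deg G u - 2) \<le> - 2\<close>, which holds because the degrees add up to the number
  of arcs.
\<close>

lemma card_leaves_ge:
  "2 + (\<Sum>u\<in>pverts G. (int (deg G u) - 3) * of_bool (3 \<le> deg G u)) + card {u \<in> pverts G. 3 \<le> deg G u}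
     \<le> card {u \<in> pverts G. deg G u = 1}"
proof -
  let ?f = "\<lambda>u. (int (deg G u) - 3) * of_bool (3 \<le> deg G u)"
  have count: "int (card {u \<in> pverts G. P u}) = (\<Sum>u\<in>pverts G. of_bool (P u))" for P
    using pair_finite_verts by (simp add: Int_def of_bool_def sum.If_cases)
  have "parcs G \<inter> pverts G \<times> pverts G = parcs G"
    by (auto dest: in_arcsD1 in_arcsD2)
  then have "(\<Sum>u\<in>pverts G. deg G u) + 2 \<le> 2 * card (pverts G)"
    using acyclic_imp_card_arcs_le[OF acyclic pair_finite_verts] branching
    by (auto simp: card_parcs_eq_sum_deg)
  then have "(\<Sum>u\<in>pverts G. int (deg G u)) + 2 \<le> 2 * int (card (pverts G))"
    unfolding of_nat_sum[symmetric] by linarith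
  then have "(\<Sum>u\<in>pverts G. int (deg G u) - 2) + 2 \<le> 0"
    by (simp add: sum_subtractf)
  also have "(\<Sum>u\<in>pverts G. int (deg G u) - 2) =
      (\<Sum>u\<in>pverts G. ?f u + of_bool (3 \<le> deg G u) - of_bool (deg G u = 1))"
  proof (rule sum.cong)
    fix u assume "u \<in> pverts G"
    then have "deg G u = 1 \<or> deg G u = 2 \<or> 3 \<le> deg G u"
      using deg_pos[of u] by linarith
    then show "int (deg G u) - 2 = ?f u + of_bool (3 \<le> deg G u) - of_bool (deg G u = 1)"
      by auto
  qed simp
  also have "\<dots> = (\<Sum>u\<in>pverts G. ?f u) + (\<Sum>u\<in>pverts G. of_bool (3 \<le> deg G u))
      - (\<Sum>u\<in>pverts G. of_bool (deg G u = 1))"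
    by (simp only: sum_subtractf sum.distrib)
  also have "\<dots> = (\<Sum>u\<in>pverts G. ?f u) + int (card {u \<in> pverts G. 3 \<le> deg G u})
      - int (card {u \<in> pverts G. deg G u = 1})"
    by (simp only: count)
  finally show ?thesis
    by linarith
qed

lemma N_plus_minus_N_minus_ge:
  "2 + (\<Sum>u\<in>pverts G. (int (deg G u) - 3) * of_bool (3 \<le> deg G u))
     \<le> int (N_plus G) - int (N_minus G)"
proof -
  let ?pos = "\<lambda>u. 0 < friendship_bias G u" and ?neg = "\<lambda>u. friendship_bias G u < 0"
  note fin = pair_finite_verts
  have split: "card {u \<in> pverts G. P u} = card {u \<in> pverts G. deg G u = 1 \<and> P u} +
      card {u \<in> pverts G. deg G u = 2 \<and> P u} + card {u \<in> pverts G. 3 \<le> deg G u \<and> P u}" for P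
  proof -
    have "{u \<in> pverts G. P u} = ({u \<in> pverts G. deg G u = 1 \<and> P u} \<union>
        {u \<in> pverts G. deg G u = 2 \<and> P u}) \<union> {u \<in> pverts G. 3 \<le> deg G u \<and> P u}"
      using deg_pos by force
    then show ?thesis
      using fin by (auto simp: card_Un_disjoint disjoint_iff)
  qed
  have "{u \<in> pverts G. deg G u = 1 \<and> ?pos u} = {u \<in> pverts G. deg G u = 1}"
    and "{u \<in> pverts G. deg G u = 1 \<and> ?neg u} = {}"
    using leaf_bias_pos by (auto dest: less_asym)
  then have plus: "N_plus G \<ge> card {u \<in> pverts G. deg G u = 1} +
        card {u \<in> pverts G. deg G u = 2 \<and> ?pos u}"
    and "N_minus G = card {u \<in> pverts G. deg G u = 2 \<and> ?neg u} +
        card {u \<in> pverts G. 3 \<le> deg G u \<and> ?neg u}"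
    unfolding N_plus_def N_minus_def using split[of ?pos] split[of ?neg] by simp_all
  moreover have "card {u \<in> pverts G. 3 \<le> deg G u \<and> ?neg u} \<le> card {u \<in> pverts G. 3 \<le> deg G u}"
    using fin by (intro card_mono) auto
  ultimately show ?thesis
    using card_neg_deg_2_le_card_pos_deg_2 card_leaves_ge by linarith
qed

end

section \<open>Paths\<close>

lemma set_vwalk_arcs_eq: "set (vwalk_arcs p) = {(p ! i, p ! Suc i) | i. Suc i < length p}"
proof (induction p rule: vwalk_arcs.induct)
  case (3 x y p)
  have "{((x # y # p) ! i, (x # y # p) ! Suc i) | i. Suc i < length (x # y # p)} =
      insert (x, y) {((y # p) ! i, (y # p) ! Suc i) | i. Suc i < length (y # p)}" (is "?L = ?R")
  proof (intro equalityI subsetI)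
    fix e assume "e \<in> ?L"
    then obtain i where "e = ((x # y # p) ! i, (x # y # p) ! Suc i)" "Suc i < length (x # y # p)"
      by blast
    then show "e \<in> ?R"
      by (cases i) auto
  next
    fix e assume "e \<in> ?R"
    then show "e \<in> ?L"
      by (auto intro: exI[of _ 0] exI[of _ "Suc _"])
  qed
  then show ?case
    using 3 by simp
qed auto

context pair_graph
begin

lemma path_graph_N_plus_minus_N_minus:
  assumes "path_graph G"
  shows "int (N_plus G) - int (N_minus G) = of_bool (card (pverts G) = 3)"
proof -
  obtain p where p: "p \<noteq> []" "distinct p" "pverts G = set p"
      "parcs G = set (vwalk_arcs p) \<union> (set (vwalk_arcs p))\<inverse>"
    using assms by (auto simp: path_graph_def)
  define n where "n = length p"
  have "0 < n" and card_verts: "card (pverts G) = n"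
    using p by (auto simp: n_def distinct_card)
  have inj: "inj_on ((!) p) A" if "A \<subseteq> {..<n}" for A
    using that by (intro inj_on_nth p(2)) (auto simp: n_def)
  \<comment> \<open>The computation takes place on positions: \<open>J i\<close> are the positions next to \<open>i\<close>.\<close>
  define J where "J i = {j. j < n \<and> (j = Suc i \<or> i = Suc j)}" for i
  have J_sub: "J i \<subseteq> {..<n}" for i
    by (auto simp: J_def)
  have nbrs: "nbrs G (p ! i) = (!) p ` J i" if "i < n" for i
    using that p(2) unfolding p(4) set_vwalk_arcs_eq J_def n_def
    by (auto simp: nth_eq_iff_index_eq)
  have deg: "deg G (p ! i) = card (J i)" if "i < n" for i
    by (simp add: deg_eq_card_nbrs nbrs[OF that] card_image[OF inj[OF J_sub]])
  have sum_nbrs: "(\<Sum>v\<in>nbrs G (p ! i). deg G v) = (\<Sum>j\<in>J i. card (J j))" if "i < n" for i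
  proof -
    have "(\<Sum>v\<in>nbrs G (p ! i). deg G v) = (\<Sum>j\<in>J i. deg G (p ! j))"
      by (simp add: nbrs[OF that] sum.reindex[OF inj[OF J_sub]])
    also have "\<dots> = (\<Sum>j\<in>J i. card (J j))"
      by (rule sum.cong) (auto simp: deg J_def)
    finally show ?thesis .
  qed
  have count: "card {u \<in> pverts G. P u} = card {i. i < n \<and> P (p ! i)}" for P
  proof -
    have "{u \<in> pverts G. P u} = (!) p ` {i. i < n \<and> P (p ! i)}"
      by (auto simp: p(3) n_def in_set_conv_nth)
    then show ?thesis
      by (simp add: card_image inj subset_iff)
  qed
  let ?S = "\<lambda>i. \<Sum>j\<in>J i. card (J j)" and ?q = "\<lambda>i. card (J i) * card (J i)"
  have "{i. i < n \<and> 0 < friendship_bias G (p ! i)} = {i. i < n \<and> ?q i < ?S i}"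
    and "{i. i < n \<and> friendship_bias G (p ! i) < 0} = {i. i < n \<and> ?S i < ?q i}"
    by (auto simp: friendship_bias_pos_iff friendship_bias_neg_iff deg sum_nbrs)
  then have N: "N_plus G = card {i. i < n \<and> ?q i < ?S i}" "N_minus G = card {i. i < n \<and> ?S i < ?q i}"
    unfolding N_plus_def N_minus_def count by simp_all
  have zero: "int (N_plus G) - int (N_minus G) = 0" if "\<And>i. i < n \<Longrightarrow> ?S i = ?q i"
  proof -
    have none: "{i. i < n \<and> ?q i < ?S i} = {}" "{i. i < n \<and> ?S i < ?q i} = {}"
      using that by auto
    show ?thesis
      unfolding N none by simp
  qed
  have J_mid: "J i = {i - 1, Suc i}" if "0 < i" "Suc i < n" for i
    using that by (auto simp: J_def)
  have J_first: "J 0 = {1}" if "2 \<le> n"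
    using that by (auto simp: J_def)
  have J_last: "J (n - 1) = {n - 2}" if "2 \<le> n"
    using that by (auto simp: J_def)
  consider "n = 1" | "n = 2" | "n = 3" | "4 \<le> n"
    using \<open>0 < n\<close> by linarith
  then show ?thesis
  proof cases
    case 1
    then have "J 0 = {}"
      by (auto simp: J_def)
    then have "?S i = ?q i" if "i < n" for i
      using that 1 by simp
    then show ?thesis
      using 1 zero by (simp add: card_verts)
  next
    case 2
    then have "J 0 = {1}" "J 1 = {0}"
      using J_first J_last by auto
    then have "?S i = ?q i" if "i < n" for i
      using that 2 by (auto simp: less_Suc_eq numeral_eq_Suc)
    then show ?thesis
      using 2 zero by (simp add: card_verts)
  next
    case 3
    have lt: "i < n \<longleftrightarrow> i = 0 \<or> i = 1 \<or> i = 2" for i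
      using 3 by auto
    have "J 0 = {1}" "J 1 = {0, 2}" "J 2 = {1}"
      using 3 by (auto simp: J_def)
    then have "?S 0 = 2" "?S 1 = 2" "?S 2 = 2" "?q 0 = 1" "?q 1 = 4" "?q 2 = 1"
      by simp_all
    then have "{i. i < n \<and> ?q i < ?S i} = {0, 2}" "{i. i < n \<and> ?S i < ?q i} = {1}"
      unfolding lt by (safe; simp)+
    then show ?thesis
      using 3 by (simp add: N card_verts)
  next
    case 4
    have deg_J: "card (J i) = (if i = 0 \<or> i = n - 1 then 1 else 2)" if "i < n" for i
    proof (cases "i = 0 \<or> i = n - 1")
      case True
      then show ?thesis
        using 4 J_first J_last by auto
    next
      case False
      then have "J i = {i - 1, Suc i}"
        using that by (intro J_mid) auto
      then show ?thesis
        using False by simp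
    qed
    have S: "?S i = (if i = 0 \<or> i = n - 1 then 2 else if i = 1 \<or> i = n - 2 then 3 else 4)"
      if i: "i < n" for i
    proof (cases "i = 0 \<or> i = n - 1")
      case True
      then have "?S i = card (J 1) \<or> ?S i = card (J (n - 2))"
        using 4 J_first J_last by auto
      moreover have "card (J 1) = 2" "card (J (n - 2)) = 2"
        using 4 deg_J[of 1] deg_J[of "n - 2"] by simp_all
      ultimately show ?thesis
        using True by argo
    next
      case False
      then have mid: "0 < i" "Suc i < n"
        using i by auto
      then have "?S i = card (J (i - 1)) + card (J (Suc i))"
        by (simp add: J_mid)
      moreover have "i - 1 = 0 \<longleftrightarrow> i = 1" "i - 1 \<noteq> n - 1" "i - 1 < n"
        "Suc i = n - 1 \<longleftrightarrow> i = n - 2" "n - 2 \<noteq> 1"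
        using mid 4 by linarith+
      ultimately show ?thesis
        using False mid by (simp add: deg_J)
    qed
    have sgn: "?q i < ?S i \<longleftrightarrow> i = 0 \<or> i = n - 1" "?S i < ?q i \<longleftrightarrow> i = 1 \<or> i = n - 2" if "i < n" for i
    proof -
      have "\<not> ((i = 0 \<or> i = n - 1) \<and> (i = 1 \<or> i = n - 2))"
        using 4 by linarith
      then show "?q i < ?S i \<longleftrightarrow> i = 0 \<or> i = n - 1" "?S i < ?q i \<longleftrightarrow> i = 1 \<or> i = n - 2"
        unfolding deg_J[OF that] S[OF that] by auto
    qed
    have "0 < n" "1 < n" "n - 1 < n" "n - 2 < n"
      using 4 by auto
    then have "{i. i < n \<and> ?q i < ?S i} = {0, n - 1}" "{i. i < n \<and> ?S i < ?q i} = {1, n - 2}"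
      using sgn by blast+
    moreover have "card {0, n - 1} = 2" "card {1, n - 2} = 2"
      using 4 by auto
    ultimately show ?thesis
      using 4 by (simp add: N card_verts)
  qed
qed

end

section \<open>Friendship-bias in finite trees\<close>

theorem theorem1p2:
  fixes G :: "'a pair_pre_digraph" and n :: nat
  assumes "undirected_tree G" and "card (pverts G) = n"
  shows "((\<exists>u \<in> pverts G. deg G u \<ge> 3) \<longrightarrow>
            int (N_plus G) - int (N_minus G)
              \<ge> 2 + (\<Sum>u \<in> pverts G. (int (deg G u) - 3) * of_bool (deg G u \<ge> 3)) \<and>
            2 + (\<Sum>u \<in> pverts G. (int (deg G u) - 3) * of_bool (deg G u \<ge> 3)) > 0)
       \<and> (path_graph G \<longrightarrow>
            int (N_plus G) - int (N_minus G) = of_bool (n = 3))"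
proof (intro conjI impI)
  have G: "pair_graph G" "Digraph_Component.connected (with_proj G)"
      "\<not> (\<exists>p. pre_digraph.cycle (with_proj G) p \<and> 3 \<le> length p)"
    using assms(1) by (auto simp: undirected_tree_def)
  show "int (N_plus G) - int (N_minus G)
      \<ge> 2 + (\<Sum>u \<in> pverts G. (int (deg G u) - 3) * of_bool (deg G u \<ge> 3))"
    if "\<exists>u \<in> pverts G. deg G u \<ge> 3"
  proof -
    interpret branching_tree G
      using G that by (simp add: branching_tree_def branching_tree_axioms_def)
    show ?thesis
      by (rule N_plus_minus_N_minus_ge)
  qed
  show "2 + (\<Sum>u \<in> pverts G. (int (deg G u) - 3) * of_bool (deg G u \<ge> 3)) > 0"
    by (rule add_pos_nonneg) (auto intro: sum_nonneg)
  show "int (N_plus G) - int (N_minus G) = of_bool (n = 3)" if "path_graph G"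
    using pair_graph.path_graph_N_plus_minus_N_minus[OF G(1) that] assms(2) by simp
qed

end
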